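(* Let $n\ge 1$ and assume the following. (I) $\|\cdot\|$ is a norm on $\mathbb{R}^n$ and $X\subset\mathbb{R}^n$ is a compact convex set containing the unit ball $\{x:\|x\|\le 1\}$. (II) $T$ is a positive integer and $\Delta>0$ is a real such that there exist $\omega_1,\dots,\omega_T\in\mathbb{R}^n$ with (a) $\|\omega_i\|_*\le 1$ for all $i\le T$, and (b) for every $(\xi_1,\dots,\xi_T)\in\{-1,1\}^T$, $$\min_{x\in X}\max_{1\le i\le T}\xi_i\langle\omega_i,x\rangle\le-\Delta .$$ (III) $M>0$ and $\rho>0$ are reals such that there exist an open convex set $\mathrm{Dom}\,\phi\subset\mathbb{R}^n$, a twice continuously differentiable convex function $\phi:\mathrm{Dom}\,\phi\to\mathbb{R}$, and a compact convex set $G\subset\mathrm{Dom}\,\phi$ satisfying: (A) $0\in\mathrm{Dom}\,\phi$, $\phi(0)=0$, $\nabla\phi(0)=0$; (B) $0\in\mathrm{int}\,G$ and $\phi(x)>\|x\|$ for all $x\in\partial G$; (C) $\langle e,\nabla^2\phi(h)e\rangle\le M\|e\|^2$ for all $e\in\mathbb{R}^n$, $h\in G$; and moreover $\max_{h\in G}\|h\|\le\rho$. Then for every $L>0$, every $\kappa\in(1,2]$, every local oracle $\mathcal{O}$ for $\mathcal{F}_{\|\cdot\|}(\kappa,L)$ and every $T$-step method $\mathcal{M}$ using this oracle, there exists $f\in\mathcal{F}_{\|\cdot\|}(\kappa,L)$ such that $$f(x_T(\mathcal{M},f))-\min_{x\in X}f(x)\ \ge\ \frac{\Delta^\kappa}{2^{\kappa+1}(\rho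 M)^{\kappa-1}}\cdot\frac{L}{T^{\kappa-1}} .$$
   Context: $\langle\cdot,\cdot\rangle$ is the standard inner product on $\mathbb{R}^n$, and $\|\cdot\|_*$ is the norm conjugate (dual) to $\|\cdot\|$: $\|\omega\|_*=\max_{\|x\|\le1}\langle\omega,x\rangle$. For $L>0$ and $\kappa\in(1,2]$, $\mathcal{F}_{\|\cdot\|}(\kappa,L)$ is the family of all continuously differentiable convex functions $f:\mathbb{R}^n\to\mathbb{R}$ such that $\|\nabla f(x)-\nabla f(y)\|_*\le L\|x-y\|^{\kappa-1}$ for all $x,y\in\mathbb{R}^n$. An oracle for a family $\mathcal{F}$ of functions on $\mathbb{R}^n$ is a function $\mathcal{O}(f,x)$ of $f\in\mathcal{F}$ and $x\in\mathbb{R}^n$ taking values in some set (the information space). It is local if $\mathcal{O}(f,x)=\mathcal{O}(g,x)$ whenever $f,g\in\mathcal{F}$ coincide in a neighbourhood of $x$. A $T$-step method $\mathcal{M}$ using oracle $\mathcal{O}$ is a collection of deterministic search rules $X_1,\dots,X_T$; applied to $f\in\mathcal{F}$ it generates points $x_t=x_t(\mathcal{M},f)=X_t\big(\{x_\tau,\mathcal{O}(f,x_\tau)\}_{\tau=1}^{t-1}\big)\in\mathbb{R}^n$, $1\le t\le T$ (so $x_1$ does not depend on $f$). The last point $x_T(\mathcal{M},f)$ is the approximate solution generated by $\mathcal{M}$. *)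

theory Defs
  imports "HOL-Analysis.Analysis"
begin

definition is_norm :: "('a::real_vector \<Rightarrow> real) \<Rightarrow> bool" where
  "is_norm N \<longleftrightarrow>
     (\<forall>x. N x \<ge> 0) \<and>
     (\<forall>x. N x = 0 \<longleftrightarrow> x = 0) \<and>
     (\<forall>a x. N (a *\<^sub>R x) = \<bar>a\<bar> * N x) \<and>
     (\<forall>x y. N (x + y) \<le> N x + N y)"

(* For a norm N the supremum is a maximum: the N-unit ball is compact and nonempty. *)
definition dual_norm :: "(real^'n \<Rightarrow> real) \<Rightarrow> real^'n \<Rightarrow> real" where
  "dual_norm N w = (SUP x\<in>{x. N x \<le> 1}. w \<bullet> x)"

(* For x = y the factor 0 powr (kappa - 1) is 0 in Isabelle, the intended value for kappa > 1. *)
definition smooth_family ::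
    "(real^'n \<Rightarrow> real) \<Rightarrow> real \<Rightarrow> real \<Rightarrow> (real^'n \<Rightarrow> real) set" where
  "smooth_family N \<kappa> L =
     {f. convex_on UNIV f \<and>
         (\<exists>g. (\<forall>x. GDERIV f x :> g x) \<and> continuous_on UNIV g \<and>
              (\<forall>x y. dual_norm N (g x - g y) \<le> L * N (x - y) powr (\<kappa> - 1)))}"

definition twice_cont_diff_on ::
    "(real^'n) set \<Rightarrow> (real^'n \<Rightarrow> real) \<Rightarrow> (real^'n \<Rightarrow> real^'n) \<Rightarrow> (real^'n \<Rightarrow> real^'n^'n) \<Rightarrow> bool" where
  "twice_cont_diff_on D \<phi> grad hess \<longleftrightarrow>
     (\<forall>x\<in>D. GDERIV \<phi> x :> grad x) \<and>
     (\<forall>x\<in>D. (grad has_derivative (\<lambda>e. hess x *v e)) (at x)) \<and>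
     continuous_on D hess"

(* An oracle is a total function here; only its values on the family matter.
   The information space is the type 'i. *)
definition local_oracle ::
    "(real^'n \<Rightarrow> real) set \<Rightarrow> ((real^'n \<Rightarrow> real) \<Rightarrow> real^'n \<Rightarrow> 'i) \<Rightarrow> bool" where
  "local_oracle F Orc \<longleftrightarrow>
     (\<forall>f\<in>F. \<forall>g\<in>F. \<forall>x. (\<exists>U. open U \<and> x \<in> U \<and> (\<forall>y\<in>U. f y = g y)) \<longrightarrow> Orc f x = Orc g x)"

(* A method is a sequence R of search rules, R t receiving the chronological list of the t - 1 pairs
   (point, oracle answer) collected so far; a T-step method uses R 1, ..., R T only. *)
type_synonym ('n, 'i) search_rules = "nat \<Rightarrow> ((real^'n) \<times> 'i) list \<Rightarrow> real^'n"

fun history ::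
    "('n::finite, 'i) search_rules \<Rightarrow> ((real^'n \<Rightarrow> real) \<Rightarrow> real^'n \<Rightarrow> 'i) \<Rightarrow> (real^'n \<Rightarrow> real)
       \<Rightarrow> nat \<Rightarrow> ((real^'n) \<times> 'i) list" where
  "history R Orc f 0 = []"
| "history R Orc f (Suc t) =
     (let h = history R Orc f t; x = R (Suc t) h in h @ [(x, Orc f x)])"

definition search_point ::
    "('n::finite, 'i) search_rules \<Rightarrow> ((real^'n \<Rightarrow> real) \<Rightarrow> real^'n \<Rightarrow> 'i) \<Rightarrow> (real^'n \<Rightarrow> real)
       \<Rightarrow> nat \<Rightarrow> real^'n" where
  "search_point R Orc f t = R t (history R Orc f (t - 1))"

end

theory Submission
  imports Defs
begin

text \<open>
  The hard functions are smoothings \<open>S x = min\<^bsub>h \<in> H\<^esub> (f (x + h) + \<Psi> h)\<close>, where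
  \<open>\<Psi> h = \<theta> \<phi> (h / \<theta>)\<close> and \<open>H = \<theta> G\<close>, of nonexpansive piecewise linear \<open>f\<close>. The minimal shift
  at \<open>x\<close> stays away from the boundary of \<open>H\<close>, so keeping \<open>x + h\<close> fixed while \<open>x\<close> moves bounds \<open>S\<close>
  from above near \<open>x\<close> by a quadratic with constant \<open>M / \<theta>\<close>; together with convexity this yields
  differentiability and an \<open>M / \<theta>\<close>-Lipschitz gradient. As \<open>S\<close> is also nonexpansive, gradients
  differ by at most \<open>2\<close>, and interpolating the two bounds gives the Hoelder condition.
  Moreover \<open>S x\<close> depends on \<open>f\<close> only within distance \<open>\<theta> \<rho>\<close> of \<open>x\<close>.

  The piecewise linear function is \<open>f = max\<^bsub>k < T\<^esub> (\<xi>\<^sub>k \<langle>\<omega>\<^bsub>\<sigma> k\<^esub>, x\<rangle> - k \<delta>)\<close>, where after the query of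
  the point with number \<open>k\<close> (counted from \<open>0\<close>) the resisting oracle chooses the unused index
  \<open>\<sigma> k\<close> with \<open>\<bar>\<langle>\<omega>\<^bsub>\<sigma> k\<^esub>, x\<rangle>\<bar>\<close> maximal and the sign making the term nonnegative. If \<open>2 \<theta> \<rho> < \<delta>\<close>, later
  choices do not affect the answer. At the last point \<open>S \<ge> - (T - 1) \<delta> - \<theta> \<rho>\<close>, whereas the minimum
  over \<open>X\<close> is at most \<open>- \<Delta>\<close>. With \<open>\<theta> = \<Delta> / (4 T \<rho>)\<close> and \<open>\<delta>\<close> slightly above \<open>\<Delta> / (2 T)\<close> the gap is at
  least \<open>\<Delta> / 2\<close>.
\<close>

section \<open>Norms on Euclidean spaces\<close>

locale finite_dim_norm =
  fixes N :: "'a::euclidean_space \<Rightarrow> real"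
  assumes is_norm: "is_norm N"
begin

lemma N_nonneg [simp]: "0 \<le> N x"
  and N_eq_0 [simp]: "N x = 0 \<longleftrightarrow> x = 0"
  and N_scaleR [simp]: "N (a *\<^sub>R x) = \<bar>a\<bar> * N x"
  and N_triangle: "N (x + y) \<le> N x + N y"
  using is_norm by (simp_all add: is_norm_def)

lemma N_zero [simp]: "N 0 = 0"
  by simp

lemma N_uminus [simp]: "N (- x) = N x"
  using N_scaleR[of "-1" x] by simp

lemma N_minus_commute: "N (x - y) = N (y - x)"
  using N_uminus[of "x - y"] by simp

lemma N_sum: "N (\<Sum>i\<in>A. f i) \<le> (\<Sum>i\<in>A. N (f i))"
proof (induction A rule: infinite_finite_induct)
  case (insert x F)
  then show ?case using N_triangle[of "f x" "sum f F"] by simp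
qed auto

lemma N_le_norm: obtains C where "C > 0" "\<And>x. N x \<le> C * norm x"
proof
  let ?C = "(\<Sum>b\<in>Basis. N b) + 1"
  show "?C > 0" by (simp add: add_nonneg_pos sum_nonneg)
  fix x :: 'a
  have "N x = N (\<Sum>b\<in>Basis. (x \<bullet> b) *\<^sub>R b)" by (simp add: euclidean_representation)
  also have "\<dots> \<le> (\<Sum>b\<in>Basis. N ((x \<bullet> b) *\<^sub>R b))" by (rule N_sum)
  also have "\<dots> \<le> (\<Sum>b\<in>Basis. norm x * N b)"
    by (auto intro!: sum_mono mult_right_mono Basis_le_norm)
  also have "\<dots> \<le> ?C * norm x" by (simp add: sum_distrib_left algebra_simps)
  finally show "N x \<le> ?C * norm x" .
qed

definition nonexpansive :: "('a \<Rightarrow> real) \<Rightarrow> bool" where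
  "nonexpansive f \<longleftrightarrow> (\<forall>x y. f x - f y \<le> N (x - y))"

lemma nonexpansiveD: "nonexpansive f \<Longrightarrow> f x - f y \<le> N (x - y)"
  by (simp add: nonexpansive_def)

lemma continuous_on_nonexpansive:
  assumes "nonexpansive f" shows "continuous_on S f"
proof -
  obtain C where C: "C > 0" "\<And>x. N x \<le> C * norm x" using N_le_norm by blast
  have "\<bar>f x - f y\<bar> \<le> C * norm (x - y)" for x y
    using nonexpansiveD[OF assms, of x y] nonexpansiveD[OF assms, of y x] C(2)[of "x - y"]
      N_minus_commute[of x y]
    by auto
  then have "C-lipschitz_on S f"
    using C(1) by (intro lipschitz_onI) (auto simp: dist_norm)
  then show ?thesis by (rule lipschitz_on_continuous_on)
qed

lemma continuous_on_N: "continuous_on S N"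
proof (rule continuous_on_nonexpansive)
  show "nonexpansive N"
    unfolding nonexpansive_def using N_triangle[of y "x - y" for x y]
    by (smt (verit) add_diff_cancel_left' add.commute diff_add_cancel)
qed

text \<open>\<open>N\<close> is continuous, so on the Euclidean unit sphere it attains a positive
  minimum, whose reciprocal serves as the constant.\<close>

lemma norm_le_N: obtains c where "c > 0" "\<And>x. norm x \<le> c * N x"
proof -
  obtain z where z: "norm z = 1" "\<And>x. norm x = 1 \<Longrightarrow> N z \<le> N x"
    using continuous_attains_inf[of "sphere 0 1" N] continuous_on_N by auto
  have "N z > 0" using z(1) N_nonneg[of z] N_eq_0[of z] by (metis norm_zero order_less_le zero_neq_one)
  moreover have "norm x \<le> 1 / N z * N x" for x
  proof (cases "x = 0")
    case False
    then have "N z \<le> N (inverse (norm x) *\<^sub>R x)" by (intro z(2)) simp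
    then show ?thesis using False \<open>N z > 0\<close> by (simp add: field_simps)
  qed auto
  ultimately show ?thesis using that[of "1 / N z"] by auto
qed

lemma compact_unit_ball: "compact {x. N x \<le> 1}"
proof -
  obtain c where "c > 0" "\<And>x. norm x \<le> c * N x" using norm_le_N by blast
  then have "norm x \<le> c" if "N x \<le> 1" for x
    using mult_left_mono[OF that, of c] by (smt (verit, best) mult.right_neutral)
  then have "bounded {x. N x \<le> 1}" by (auto intro: boundedI)
  moreover have "closed {x. N x \<le> 1}"
    by (intro closed_Collect_le continuous_on_N continuous_intros)
  ultimately show ?thesis by (simp add: compact_eq_bounded_closed)
qed

lemma inner_le_of_unit_ball:
  assumes "\<And>v. N v \<le> 1 \<Longrightarrow> w \<bullet> v \<le> c"
  shows "w \<bullet> x \<le> c * N x"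
proof (cases "x = 0")
  case False
  then have "N x > 0" using N_nonneg[of x] N_eq_0[of x] by linarith
  then have "w \<bullet> ((1 / N x) *\<^sub>R x) \<le> c" by (intro assms) simp
  then show ?thesis using \<open>N x > 0\<close> by (simp add: field_simps)
qed simp

subsection \<open>Convex functions with a local quadratic upper bound\<close>

text \<open>\<open>x\<close> is a convex combination of \<open>x + e\<close> and the backward point
  \<open>x - t *\<^sub>R e\<close>. Convexity turns the upper bound at the backward point into a
  lower bound at \<open>x + e\<close>, with an error that vanishes as \<open>t\<close> tends to
  0.\<close>

lemma above_tangent:
  assumes conv: "convex_on UNIV S" and "r > 0"
    and up: "\<And>e. N e \<le> r \<Longrightarrow> S (x + e) \<le> S x + p \<bullet> e + A / 2 * (N e)\<^sup>2"
  shows "S x + p \<bullet> e \<le> S (x + e)"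
proof -
  have ineq: "S x + p \<bullet> e \<le> S (x + e) + A / 2 * (N e)\<^sup>2 * t" if t: "t > 0" "t * N e \<le> r" for t
  proof -
    have one: "1 / (1 + t) + t / (1 + t) = 1" using t by (simp add: field_simps)
    have "S ((1 / (1 + t)) *\<^sub>R (x - t *\<^sub>R e) + (t / (1 + t)) *\<^sub>R (x + e))
        \<le> 1 / (1 + t) * S (x - t *\<^sub>R e) + t / (1 + t) * S (x + e)"
      using convex_onD[OF conv, of "t / (1 + t)" "x - t *\<^sub>R e" "x + e"] t
      by (simp add: eq_diff_eq[THEN iffD2, OF one])
    also have "(1 / (1 + t)) *\<^sub>R (x - t *\<^sub>R e) + (t / (1 + t)) *\<^sub>R (x + e)
        = (1 / (1 + t) + t / (1 + t)) *\<^sub>R x"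
      by (simp add: algebra_simps)
    also note one
    also have "1 / (1 + t) * S (x - t *\<^sub>R e) + t / (1 + t) * S (x + e)
        = (S (x - t *\<^sub>R e) + t * S (x + e)) / (1 + t)"
      by (simp add: add_divide_distrib)
    finally have "(1 + t) * S x \<le> S (x - t *\<^sub>R e) + t * S (x + e)"
      using t by (simp add: pos_le_divide_eq mult.commute)
    also have "S (x - t *\<^sub>R e) \<le> S x - t * (p \<bullet> e) + A / 2 * (t * N e)\<^sup>2"
      using up[of "- (t *\<^sub>R e)"] t by (simp add: power_mult_distrib)
    finally have "t * (S x + p \<bullet> e) \<le> t * (S (x + e) + A / 2 * (N e)\<^sup>2 * t)"
      by (simp add: algebra_simps power2_eq_square)
    then show ?thesis using t by simp
  qed
  have lim: "((\<lambda>t. S (x + e) + A / 2 * (N e)\<^sup>2 * t) \<longlongrightarrow> S (x + e) + A / 2 * (N e)\<^sup>2 * 0) (at_right 0)"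
    by (intro tendsto_intros)
  \<comment> \<open>The summand 1 keeps the quotient meaningful for \<open>e = 0\<close>.\<close>
  have "eventually (\<lambda>t. t \<in> {0<..<r / (N e + 1)}) (at_right 0)"
    using \<open>r > 0\<close> by (intro eventually_at_right_real) (simp add: add_nonneg_pos)
  then have "eventually (\<lambda>t. S x + p \<bullet> e \<le> S (x + e) + A / 2 * (N e)\<^sup>2 * t) (at_right 0)"
  proof eventually_elim
    case (elim t)
    then have "t * (N e + 1) < r" using N_nonneg[of e] by (simp add: field_simps)
    then show ?case using elim by (intro ineq) (auto simp: algebra_simps)
  qed
  from tendsto_lowerbound[OF lim this] show ?thesis by simp
qed

text \<open>\<open>S\<close> is squeezed between the tangent given by \<open>above_tangent\<close>
  and the quadratic, so it deviates from the affine function by at most a multiple of the squared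
  Euclidean norm.\<close>

lemma gderiv_of_quadratic_bound:
  assumes conv: "convex_on UNIV S" and "r > 0"
    and up: "\<And>e. N e \<le> r \<Longrightarrow> S (x + e) \<le> S x + p \<bullet> e + A / 2 * (N e)\<^sup>2"
  shows "GDERIV S x :> p"
  unfolding gderiv_def
proof -
  obtain C where C: "C > 0" "\<And>x. N x \<le> C * norm x" using N_le_norm by blast
  define B where "B = \<bar>A\<bar> / 2 * C\<^sup>2"
  show "(S has_derivative (\<lambda>h. h \<bullet> p)) (at x)"
  proof (rule has_derivativeI_sandwich[where e = "r / C" and H = "\<lambda>y. B * norm (y - x)"])
    show "0 < r / C" using C(1) \<open>r > 0\<close> by simp
    show "bounded_linear (\<lambda>h. h \<bullet> p)" by (rule bounded_linear_inner_left)
    show "((\<lambda>y. B * norm (y - x)) \<longlongrightarrow> 0) (at x)"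
      by (rule tendsto_eq_intros refl | simp)+
    fix y assume y: "y \<noteq> x" "dist y x < r / C"
    define e where "e = y - x"
    have ye: "y = x + e" by (simp add: e_def)
    have "C * norm e < r" using y C(1) by (simp add: e_def dist_norm field_simps)
    then have Ne: "N e \<le> r" using C(2)[of e] by simp
    have "A / 2 * (N e)\<^sup>2 \<le> \<bar>A\<bar> / 2 * (C * norm e)\<^sup>2"
      using C by (intro mult_mono power_mono) auto
    then have "A / 2 * (N e)\<^sup>2 \<le> B * norm e * norm e"
      by (simp add: B_def power2_eq_square algebra_simps)
    then have "norm (S y - S x - e \<bullet> p) \<le> B * norm e * norm e"
      using up[OF Ne] above_tangent[OF conv \<open>r > 0\<close> up, of e] by (simp add: ye inner_commute)
    then show "norm (S y - S x - (y - x) \<bullet> p) / norm (y - x) \<le> B * norm (y - x)"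
      using y(1) by (simp add: e_def[symmetric] divide_le_eq)
  qed
qed

text \<open>The two tangent inequalities at \<open>y\<close> and \<open>x\<close>, tested at the points \<open>x - s v\<close> and \<open>y + s v\<close>
  with \<open>s = N (x - y)\<close>, give the constant \<open>A\<close> without any second derivative.\<close>

lemma gradient_lipschitz_local:
  assumes conv: "convex_on UNIV S" and "r > 0" and "A \<ge> 0"
    and up: "\<And>x e. N e \<le> r \<Longrightarrow> S (x + e) \<le> S x + g x \<bullet> e + A / 2 * (N e)\<^sup>2"
    and xy: "N (x - y) \<le> r" and "N v \<le> 1"
  shows "(g x - g y) \<bullet> v \<le> A * N (x - y)"
proof (cases "x = y")
  case False
  define s where "s = N (x - y)"
  have s: "s > 0" "s \<le> r" using False xy N_nonneg[of "x - y"] N_eq_0[of "x - y"]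
    by (auto simp: s_def less_le simp del: N_nonneg)
  have "continuous_on {x. N x \<le> 1} (\<lambda>w. (g x - g y) \<bullet> w)" by (intro continuous_intros)
  moreover have "0 \<in> {x. N x \<le> 1}" by simp
  ultimately obtain v0
    where v0: "N v0 \<le> 1" "\<And>w. N w \<le> 1 \<Longrightarrow> (g x - g y) \<bullet> w \<le> (g x - g y) \<bullet> v0"
    using continuous_attains_sup[OF compact_unit_ball] by blast
  note tangent = above_tangent[OF conv \<open>r > 0\<close> up]
  have sv: "N (s *\<^sub>R v0) \<le> s" "A / 2 * (N (s *\<^sub>R v0))\<^sup>2 \<le> A / 2 * s\<^sup>2"
    using v0(1) s \<open>A \<ge> 0\<close> by (auto simp: mult_le_cancel_left1 intro!: mult_left_mono power_mono)
  have "s * N v0 \<le> r" using order_trans[OF sv(1) s(2)] s(1) by simp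
  note sv = sv this
  have "S y + g y \<bullet> (x - y - s *\<^sub>R v0) \<le> S (x - s *\<^sub>R v0)"
    using tangent[of y "x - y - s *\<^sub>R v0"] by simp
  also have "\<dots> \<le> S x - s * (g x \<bullet> v0) + A / 2 * s\<^sup>2"
    using up[of "- (s *\<^sub>R v0)" x] sv s by simp
  finally have 1: "S y + g y \<bullet> (x - y - s *\<^sub>R v0) \<le> S x - s * (g x \<bullet> v0) + A / 2 * s\<^sup>2" .
  have "S x + g x \<bullet> (y - x + s *\<^sub>R v0) \<le> S (y + s *\<^sub>R v0)"
    using tangent[of x "y - x + s *\<^sub>R v0"] by simp
  also have "\<dots> \<le> S y + s * (g y \<bullet> v0) + A / 2 * s\<^sup>2"
    using up[of "s *\<^sub>R v0" y] sv s by simp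
  finally have 2: "S x + g x \<bullet> (y - x + s *\<^sub>R v0) \<le> S y + s * (g y \<bullet> v0) + A / 2 * s\<^sup>2" .
  from 1 2 have "2 * s * ((g x - g y) \<bullet> v0) \<le> (g x - g y) \<bullet> (x - y) + A * s\<^sup>2"
    by (simp add: inner_simps algebra_simps)
  \<comment> \<open>Maximality of \<open>v0\<close> on the unit ball bounds this pairing, so one of
    the two copies on the left is absorbed.\<close>
  also have "(g x - g y) \<bullet> (x - y) \<le> s * ((g x - g y) \<bullet> v0)"
    using inner_le_of_unit_ball[OF v0(2), of "x - y"] by (simp add: s_def mult.commute)
  finally have "s * ((g x - g y) \<bullet> v0) \<le> s * (A * s)"
    by (simp add: power2_eq_square algebra_simps)
  then have "(g x - g y) \<bullet> v0 \<le> A * s" using s by simp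
  then show ?thesis using v0(2)[OF \<open>N v \<le> 1\<close>] by (simp add: s_def)
qed simp

text \<open>The segment is cut into \<open>m\<close> equal pieces of \<open>N\<close>-length at most
  \<open>r\<close>. The local bounds add up without loss, so \<open>r\<close> does not enter the
  constant.\<close>

lemma gradient_lipschitz:
  assumes conv: "convex_on UNIV S" and "r > 0" and "A \<ge> 0"
    and up: "\<And>x e. N e \<le> r \<Longrightarrow> S (x + e) \<le> S x + g x \<bullet> e + A / 2 * (N e)\<^sup>2"
    and "N v \<le> 1"
  shows "(g x - g y) \<bullet> v \<le> A * N (x - y)"
proof -
  obtain m :: nat where m: "N (x - y) / r < real m" using reals_Archimedean2 by blast
  have "N (x - y) / r \<ge> 0" using \<open>r > 0\<close> by simp
  then have m0: "real m > 0" using m by linarith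
  define z where "z k = y + (real k / real m) *\<^sub>R (x - y)" for k :: nat
  have diff: "z (Suc k) - z k = (1 / real m) *\<^sub>R (x - y)" for k
    by (simp add: z_def scaleR_left_distrib add_divide_distrib)
  have Nz: "N (z (Suc k) - z k) = N (x - y) / real m" for k
    unfolding diff using m0 by simp
  have "N (x - y) / real m \<le> r" using m m0 \<open>r > 0\<close> by (simp add: field_simps)
  then have step: "(g (z (Suc k)) - g (z k)) \<bullet> v \<le> A * (N (x - y) / real m)" for k
    using gradient_lipschitz_local[OF conv \<open>r > 0\<close> \<open>A \<ge> 0\<close> up, of "z (Suc k)" "z k" v] \<open>N v \<le> 1\<close>
    by (simp add: Nz)
  have "(g x - g y) \<bullet> v = (g (z m) - g (z 0)) \<bullet> v" using m0 by (simp add: z_def)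
  also have "\<dots> = (\<Sum>k<m. (g (z (Suc k)) - g (z k)) \<bullet> v)"
    by (simp add: inner_sum_left[symmetric] sum_lessThan_telescope[of "\<lambda>k. g (z k)"])
  also have "\<dots> \<le> (\<Sum>k<m. A * (N (x - y) / real m))" by (intro sum_mono step)
  also have "\<dots> = A * N (x - y)" using m0 by simp
  finally show ?thesis .
qed

end

section \<open>Smoothing by infimal convolution\<close>

text \<open>\<open>p\<close> plays the gradient of \<open>\<Psi>\<close>. The conditions on
  \<open>h - e\<close> concern only \<open>\<Psi> h \<le> N h\<close>, where all minimal shifts lie;
  \<open>r\<close> is uniform in \<open>h\<close>, so that local estimates can be chained.\<close>

locale smoothing_kernel = finite_dim_norm N for N :: "'a::euclidean_space \<Rightarrow> real" +
  fixes H :: "'a set" and \<Psi> :: "'a \<Rightarrow> real" and p :: "'a \<Rightarrow> 'a" and \<rho> r A :: real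
  assumes compact_H: "compact H"
    and convex_\<Psi>: "convex_on H \<Psi>"
    and continuous_\<Psi>: "continuous_on H \<Psi>"
    and zero_in_H: "0 \<in> H"
    and \<Psi>_zero: "\<Psi> 0 = 0"
    and \<Psi>_nonneg: "h \<in> H \<Longrightarrow> 0 \<le> \<Psi> h"
    and N_le_\<rho>: "h \<in> H \<Longrightarrow> N h \<le> \<rho>"
    and r_pos: "r > 0" and A_nonneg: "A \<ge> 0"
    and shift_in_H: "\<lbrakk>h \<in> H; \<Psi> h \<le> N h; N e \<le> r\<rbrakk> \<Longrightarrow> h - e \<in> H"
    and \<Psi>_shift_le:
      "\<lbrakk>h \<in> H; \<Psi> h \<le> N h; N e \<le> r\<rbrakk> \<Longrightarrow> \<Psi> (h - e) \<le> \<Psi> h - p h \<bullet> e + A / 2 * (N e)\<^sup>2"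
begin

definition smoothing :: "('a \<Rightarrow> real) \<Rightarrow> 'a \<Rightarrow> real" where
  "smoothing f x = (INF h\<in>H. f (x + h) + \<Psi> h)"

definition min_shift :: "('a \<Rightarrow> real) \<Rightarrow> 'a \<Rightarrow> 'a" where
  "min_shift f x = (SOME h. h \<in> H \<and> (\<forall>h'\<in>H. f (x + h) + \<Psi> h \<le> f (x + h') + \<Psi> h'))"

text \<open>Envelope formula: with \<open>x + h\<close> held fixed, the first-order change comes
  from \<open>\<Psi>\<close> alone.\<close>

definition smoothing_grad :: "('a \<Rightarrow> real) \<Rightarrow> 'a \<Rightarrow> 'a" where
  "smoothing_grad f x = - p (min_shift f x)"

lemma convex_H: "convex H"
  using convex_\<Psi> by (simp add: convex_on_def)

lemma smoothing_cong: "(\<And>h. h \<in> H \<Longrightarrow> f (x + h) = g (x + h)) \<Longrightarrow> smoothing f x = smoothing g x"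
  by (simp add: smoothing_def)

context
  fixes f :: "'a \<Rightarrow> real"
  assumes f: "nonexpansive f"
begin

lemma
  shows min_shift_in_H: "min_shift f x \<in> H"
    and smoothing_eq: "smoothing f x = f (x + min_shift f x) + \<Psi> (min_shift f x)"
    and smoothing_le: "h \<in> H \<Longrightarrow> smoothing f x \<le> f (x + h) + \<Psi> h"
proof -
  have "continuous_on H (\<lambda>h. f (x + h) + \<Psi> h)"
    by (intro continuous_on_add continuous_\<Psi> continuous_on_compose2[OF continuous_on_nonexpansive[OF f, of UNIV]]
        continuous_intros) auto
  then have "\<exists>h. h \<in> H \<and> (\<forall>h'\<in>H. f (x + h) + \<Psi> h \<le> f (x + h') + \<Psi> h')"
    using continuous_attains_inf[OF compact_H] zero_in_H by blast
  then have *: "min_shift f x \<in> H \<and>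
      (\<forall>h'\<in>H. f (x + min_shift f x) + \<Psi> (min_shift f x) \<le> f (x + h') + \<Psi> h')"
    unfolding min_shift_def by (rule someI_ex)
  then show "min_shift f x \<in> H" by simp
  show eq: "smoothing f x = f (x + min_shift f x) + \<Psi> (min_shift f x)"
    unfolding smoothing_def using * by (intro cInf_eq_minimum) auto
  show "smoothing f x \<le> f (x + h) + \<Psi> h" if "h \<in> H"
    using * that by (simp add: eq)
qed

lemma smoothing_upper: "smoothing f x \<le> f x"
  using smoothing_le[OF zero_in_H, of x] by (simp add: \<Psi>_zero)

lemma smoothing_lower: "f x - \<rho> \<le> smoothing f x"
  using smoothing_eq[of x] nonexpansiveD[OF f, of x "x + min_shift f x"] min_shift_in_H[of x]
    \<Psi>_nonneg[of "min_shift f x"] N_le_\<rho>[of "min_shift f x"] by simp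

text \<open>Competing with the shift \<open>0\<close> keeps the minimal shift in the region
  where \<^term>\<open>\<Psi> h \<le> N h\<close>, hence away from the boundary of \<^term>\<open>H\<close>.\<close>

lemma \<Psi>_min_shift_le: "\<Psi> (min_shift f x) \<le> N (min_shift f x)"
  using smoothing_eq[of x] nonexpansiveD[OF f, of x "x + min_shift f x"] smoothing_upper[of x]
  by simp

text \<open>The shift \<open>h - e\<close> at \<open>x + e\<close> reaches the same point as the
  minimal shift \<open>h\<close> at \<open>x\<close>, so only the change in \<open>\<Psi>\<close>
  remains.\<close>

lemma smoothing_quadratic_bound:
  assumes "N e \<le> r"
  shows "smoothing f (x + e) \<le> smoothing f x + smoothing_grad f x \<bullet> e + A / 2 * (N e)\<^sup>2"
proof -
  let ?h = "min_shift f x"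
  have "?h - e \<in> H"
    by (intro shift_in_H min_shift_in_H \<Psi>_min_shift_le assms)
  then have "smoothing f (x + e) \<le> f (x + ?h) + \<Psi> (?h - e)"
    using smoothing_le[of "?h - e" "x + e"] by simp
  also have "\<Psi> (?h - e) \<le> \<Psi> ?h - p ?h \<bullet> e + A / 2 * (N e)\<^sup>2"
    by (intro \<Psi>_shift_le min_shift_in_H \<Psi>_min_shift_le assms)
  finally show ?thesis by (simp add: smoothing_eq smoothing_grad_def)
qed

text \<open>The minimal shift at \<open>y\<close> competes at \<open>x\<close> with the same
  penalty.\<close>

lemma nonexpansive_smoothing: "nonexpansive (smoothing f)"
  unfolding nonexpansive_def
proof (intro allI)
  fix x y
  show "smoothing f x - smoothing f y \<le> N (x - y)"
    using smoothing_le[OF min_shift_in_H[of y], of x] smoothing_eq[of y]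
      nonexpansiveD[OF f, of "x + min_shift f y" "y + min_shift f y"] by simp
qed

context
  assumes convex_f: "convex_on UNIV f"
begin

text \<open>The convex combination of the two minimal shifts lies in \<open>H\<close> and competes
  at the combined point.\<close>

lemma convex_smoothing: "convex_on UNIV (smoothing f)"
proof (rule convex_onI)
  fix t :: real and x y :: 'a
  assume t: "0 < t" "t < 1"
  let ?a = "min_shift f x" and ?b = "min_shift f y"
  let ?h = "(1 - t) *\<^sub>R ?a + t *\<^sub>R ?b"
  have "?h \<in> H"
    using t by (intro convexD[OF convex_H] min_shift_in_H) auto
  then have "smoothing f ((1 - t) *\<^sub>R x + t *\<^sub>R y) \<le> f ((1 - t) *\<^sub>R x + t *\<^sub>R y + ?h) + \<Psi> ?h"
    by (rule smoothing_le)
  also have "(1 - t) *\<^sub>R x + t *\<^sub>R y + ?h = (1 - t) *\<^sub>R (x + ?a) + t *\<^sub>R (y + ?b)"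
    by (simp add: algebra_simps)
  also have "f \<dots> \<le> (1 - t) * f (x + ?a) + t * f (y + ?b)"
    using t by (intro convex_onD[OF convex_f]) auto
  also have "\<Psi> ?h \<le> (1 - t) * \<Psi> ?a + t * \<Psi> ?b"
    using t by (intro convex_onD[OF convex_\<Psi>] min_shift_in_H) auto
  finally show "smoothing f ((1 - t) *\<^sub>R x + t *\<^sub>R y) \<le> (1 - t) * smoothing f x + t * smoothing f y"
    by (simp add: smoothing_eq algebra_simps)
qed simp

lemmas smoothing_above_tangent =
  above_tangent[OF convex_smoothing r_pos smoothing_quadratic_bound]

lemma gderiv_smoothing: "GDERIV (smoothing f) x :> smoothing_grad f x"
  by (rule gderiv_of_quadratic_bound[OF convex_smoothing r_pos smoothing_quadratic_bound])

lemma smoothing_grad_lipschitz: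
  "N v \<le> 1 \<Longrightarrow> (smoothing_grad f x - smoothing_grad f y) \<bullet> v \<le> A * N (x - y)"
  by (rule gradient_lipschitz[OF convex_smoothing r_pos A_nonneg smoothing_quadratic_bound])

lemma smoothing_grad_le: "smoothing_grad f x \<bullet> v \<le> N v"
  using smoothing_above_tangent[of x v] nonexpansiveD[OF nonexpansive_smoothing, of "x + v" x] by simp

text \<open>Each gradient has dual norm at most 1. Unlike the Lipschitz bound, this one does not
  deteriorate for distant points.\<close>

lemma smoothing_grad_diff_le:
  assumes "N v \<le> 1"
  shows "(smoothing_grad f x - smoothing_grad f y) \<bullet> v \<le> 2"
  using smoothing_grad_le[of x v] smoothing_grad_le[of y "- v"] assms
  by (simp add: inner_diff_left)

lemma continuous_smoothing_grad: "continuous_on UNIV (smoothing_grad f)"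
proof -
  obtain C where C: "C > 0" "\<And>x. N x \<le> C * norm x" using N_le_norm by blast
  have "norm (smoothing_grad f x - smoothing_grad f y) \<le> A * C\<^sup>2 * norm (x - y)" for x y
  proof (cases "smoothing_grad f x = smoothing_grad f y")
    case False
    define d where "d = smoothing_grad f x - smoothing_grad f y"
    have d: "d \<noteq> 0" using False by (simp add: d_def)
    \<comment> \<open>Pairing the difference \<open>d\<close> with itself turns the dual estimate
      into a Euclidean one.\<close>
    have "(norm d)\<^sup>2 \<le> A * N (x - y) * N d"
      using inner_le_of_unit_ball[OF smoothing_grad_lipschitz, of x y d]
      by (simp add: d_def power2_norm_eq_inner)
    also have "\<dots> \<le> A * (C * norm (x - y)) * (C * norm d)"
      using A_nonneg C by (intro mult_mono mult_left_mono) auto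
    finally have "norm d * norm d \<le> (A * C\<^sup>2 * norm (x - y)) * norm d"
      by (simp add: power2_eq_square algebra_simps)
    then show ?thesis using d by (simp add: d_def[symmetric])
  qed (use A_nonneg in simp)
  then have "(A * C\<^sup>2)-lipschitz_on UNIV (smoothing_grad f)"
    using A_nonneg by (intro lipschitz_onI) (auto simp: dist_norm)
  then show ?thesis by (rule lipschitz_on_continuous_on)
qed

end

end

end

text \<open>Penalty and norm both scale to first degree, so the region
  \<open>\<Psi> h \<le> N h\<close> is preserved. The radius is multiplied and the curvature divided
  by \<open>\<theta>\<close>: locality is traded for smoothness.\<close>

lemma (in smoothing_kernel) smoothing_kernel_scaleR:
  assumes "\<theta> > 0"
  shows "smoothing_kernel N ((*\<^sub>R) \<theta> ` H) (\<lambda>h. \<theta> * \<Psi> (h /\<^sub>R \<theta>)) (\<lambda>h. p (h /\<^sub>R \<theta>))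
    (\<theta> * \<rho>) (\<theta> * r) (A / \<theta>)"
proof -
  have mem: "h \<in> (*\<^sub>R) \<theta> ` H \<longleftrightarrow> h /\<^sub>R \<theta> \<in> H" for h
    using assms by (force simp: image_iff)
  have shift: "(h - e) /\<^sub>R \<theta> = h /\<^sub>R \<theta> - e /\<^sub>R \<theta>" for h e :: 'a
    by (simp add: algebra_simps)
  have Nle: "N (e /\<^sub>R \<theta>) \<le> r" if "N e \<le> \<theta> * r" for e
    using that assms by (simp add: field_simps)
  have level: "\<Psi> (h /\<^sub>R \<theta>) \<le> N (h /\<^sub>R \<theta>)" if "\<theta> * \<Psi> (h /\<^sub>R \<theta>) \<le> N h" for h
    using that assms by (simp add: field_simps)
  show ?thesis
  proof (unfold_locales, unfold mem)
    show "compact ((*\<^sub>R) \<theta> ` H)" by (intro compact_scaling compact_H)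
    show "continuous_on ((*\<^sub>R) \<theta> ` H) (\<lambda>h. \<theta> * \<Psi> (h /\<^sub>R \<theta>))"
      using assms by (intro continuous_intros continuous_on_compose2[OF continuous_\<Psi>]) auto
    show "convex_on ((*\<^sub>R) \<theta> ` H) (\<lambda>h. \<theta> * \<Psi> (h /\<^sub>R \<theta>))"
    proof (rule convex_on_cmul, use assms in simp, rule convex_onI)
      fix t :: real and x y :: 'a assume t: "0 < t" "t < 1" and xy: "x \<in> (*\<^sub>R) \<theta> ` H" "y \<in> (*\<^sub>R) \<theta> ` H"
      have "((1 - t) *\<^sub>R x + t *\<^sub>R y) /\<^sub>R \<theta> = (1 - t) *\<^sub>R (x /\<^sub>R \<theta>) + t *\<^sub>R (y /\<^sub>R \<theta>)"
        by (simp add: algebra_simps)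
      then show "\<Psi> (((1 - t) *\<^sub>R x + t *\<^sub>R y) /\<^sub>R \<theta>) \<le> (1 - t) * \<Psi> (x /\<^sub>R \<theta>) + t * \<Psi> (y /\<^sub>R \<theta>)"
        using convex_onD[OF convex_\<Psi>, of t "x /\<^sub>R \<theta>" "y /\<^sub>R \<theta>"] t xy by (simp add: mem)
    qed (intro convex_scaling convex_H)
    show "\<theta> * \<Psi> ((h - e) /\<^sub>R \<theta>) \<le> \<theta> * \<Psi> (h /\<^sub>R \<theta>) - p (h /\<^sub>R \<theta>) \<bullet> e + A / \<theta> / 2 * (N e)\<^sup>2"
      if "h /\<^sub>R \<theta> \<in> H" "\<theta> * \<Psi> (h /\<^sub>R \<theta>) \<le> N h" "N e \<le> \<theta> * r" for h e
      using mult_left_mono[OF \<Psi>_shift_le[OF that(1) level[OF that(2)] Nle[OF that(3)]], of \<theta>] assms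
      by (simp add: shift algebra_simps power2_eq_square inverse_eq_divide)
    show "(h - e) /\<^sub>R \<theta> \<in> H"
      if "h /\<^sub>R \<theta> \<in> H" "\<theta> * \<Psi> (h /\<^sub>R \<theta>) \<le> N h" "N e \<le> \<theta> * r" for h e
      unfolding shift by (rule shift_in_H[OF that(1) level[OF that(2)] Nle[OF that(3)]])
    show "N h \<le> \<theta> * \<rho>" if "h /\<^sub>R \<theta> \<in> H" for h
      using N_le_\<rho>[OF that] assms by (simp add: field_simps)
  qed (use assms zero_in_H \<Psi>_zero \<Psi>_nonneg r_pos A_nonneg in auto)
qed

section \<open>Dual norm and inner products\<close>

lemma dual_norm_leI:
  assumes "is_norm N" "\<And>v. N v \<le> 1 \<Longrightarrow> w \<bullet> v \<le> c"
  shows "dual_norm N w \<le> c"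
proof -
  have "N 0 = 0" using assms(1) by (simp add: is_norm_def)
  then have "0 \<in> {x. N x \<le> 1}" by simp
  then show ?thesis
    unfolding dual_norm_def using assms(2) by (intro cSUP_least) auto
qed

lemma inner_le_of_dual_norm_le:
  assumes "is_norm N" "dual_norm N w \<le> 1"
  shows "\<bar>w \<bullet> x\<bar> \<le> N x"
proof -
  interpret finite_dim_norm N by (rule finite_dim_norm.intro[OF assms(1)])
  \<comment> \<open>Compactness of the unit ball makes the \<open>SUP\<close> in
    \<open>dual_norm\<close> a genuine upper bound.\<close>
  have "bdd_above ((\<lambda>x. w \<bullet> x) ` {x. N x \<le> 1})"
    by (intro bounded_imp_bdd_above compact_imp_bounded compact_continuous_image
        compact_unit_ball continuous_intros)
  then have "w \<bullet> v \<le> dual_norm N w" if "N v \<le> 1" for v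
    unfolding dual_norm_def using that by (intro cSUP_upper) auto
  then have 1: "w \<bullet> v \<le> 1" if "N v \<le> 1" for v
    using that assms(2) by (meson order_trans)
  have "w \<bullet> x \<le> N x" for x using inner_le_of_unit_ball[OF 1] by simp
  from this[of x] this[of "- x"] show ?thesis by simp
qed

section \<open>Smoothing kernels from barrier functions\<close>

text \<open>Taylor's bound on the segment by two monotonicity arguments: first the directional
  derivative minus \<open>B * t\<close> decreases, then the function minus its quadratic majorant
  does.\<close>

lemma second_order_upper_bound:
  fixes \<phi> :: "real^'n \<Rightarrow> real"
  assumes diff: "twice_cont_diff_on D \<phi> grad hess"
    and "convex G" "G \<subseteq> D" and hess: "\<And>h. h \<in> G \<Longrightarrow> e \<bullet> (hess h *v e) \<le> B"
    and mem: "x \<in> G" "x + e \<in> G"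
  shows "\<phi> (x + e) \<le> \<phi> x + grad x \<bullet> e + B / 2"
proof -
  have seg: "x + t *\<^sub>R e \<in> G" if "0 \<le> t" "t \<le> 1" for t
    using convexD_alt[OF \<open>convex G\<close> mem, of t] that by (simp add: algebra_simps)
  have d1: "((\<lambda>t. \<phi> (x + t *\<^sub>R e)) has_real_derivative grad (x + t *\<^sub>R e) \<bullet> e) (at t)"
    if "0 \<le> t" "t \<le> 1" for t
  proof -
    have outer: "(\<phi> has_derivative (\<lambda>h. h \<bullet> grad (x + t *\<^sub>R e))) (at (x + t *\<^sub>R e))"
      using diff seg[OF that] \<open>G \<subseteq> D\<close> by (auto simp: twice_cont_diff_on_def gderiv_def)
    have inner: "((\<lambda>t. x + t *\<^sub>R e) has_derivative (\<lambda>s. s *\<^sub>R e)) (at t)"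
      by (auto intro!: derivative_eq_intros)
    from has_derivative_compose[OF inner outer] show ?thesis
      unfolding has_field_derivative_def
      by (rule has_derivative_eq_rhs) (simp add: fun_eq_iff inner_commute)
  qed
  have d2: "((\<lambda>t. grad (x + t *\<^sub>R e) \<bullet> e) has_real_derivative e \<bullet> (hess (x + t *\<^sub>R e) *v e)) (at t)"
    if "0 \<le> t" "t \<le> 1" for t
  proof -
    have outer: "(grad has_derivative (\<lambda>h. hess (x + t *\<^sub>R e) *v h)) (at (x + t *\<^sub>R e))"
      using diff seg[OF that] \<open>G \<subseteq> D\<close> by (auto simp: twice_cont_diff_on_def)
    have inner: "((\<lambda>t. x + t *\<^sub>R e) has_derivative (\<lambda>s. s *\<^sub>R e)) (at t)"
      by (auto intro!: derivative_eq_intros)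
    have "((\<lambda>t. grad (x + t *\<^sub>R e)) has_derivative
        (\<lambda>s. hess (x + t *\<^sub>R e) *v (s *\<^sub>R e))) (at t)"
      by (rule has_derivative_compose[OF inner outer])
    from has_derivative_inner_left[OF this, of e] show ?thesis
      unfolding has_field_derivative_def
      by (rule has_derivative_eq_rhs) (simp add: fun_eq_iff matrix_vector_mult_scaleR inner_commute)
  qed
  have g: "grad (x + t *\<^sub>R e) \<bullet> e \<le> grad x \<bullet> e + B * t" if t: "0 \<le> t" "t \<le> 1" for t
  proof -
    have "grad (x + t *\<^sub>R e) \<bullet> e - B * t \<le> grad (x + 0 *\<^sub>R e) \<bullet> e - B * 0"
    proof (rule DERIV_nonpos_imp_nonincreasing[OF t(1)])
      fix s assume s: "0 \<le> s" "s \<le> t"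
      then have "((\<lambda>t. grad (x + t *\<^sub>R e) \<bullet> e - B * t) has_real_derivative
          e \<bullet> (hess (x + s *\<^sub>R e) *v e) - B * 1) (at s)"
        using t by (intro derivative_intros d2) auto
      then show "\<exists>y. ((\<lambda>t. grad (x + t *\<^sub>R e) \<bullet> e - B * t) has_real_derivative y) (at s) \<and> y \<le> 0"
        using hess[OF seg[of s]] s t by (intro exI conjI) auto
    qed
    then show ?thesis by simp
  qed
  have "\<phi> (x + 1 *\<^sub>R e) - grad x \<bullet> e * 1 - B / 2 * 1\<^sup>2 \<le> \<phi> (x + 0 *\<^sub>R e) - grad x \<bullet> e * 0 - B / 2 * 0\<^sup>2"
  proof (rule DERIV_nonpos_imp_nonincreasing
      [where f = "\<lambda>t. \<phi> (x + t *\<^sub>R e) - grad x \<bullet> e * t - B / 2 * t\<^sup>2"])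
    fix s :: real assume s: "0 \<le> s" "s \<le> 1"
    have "((\<lambda>t. \<phi> (x + t *\<^sub>R e) - grad x \<bullet> e * t - B / 2 * t\<^sup>2) has_real_derivative
        grad (x + s *\<^sub>R e) \<bullet> e - grad x \<bullet> e - B * s) (at s)"
      using s by (auto intro!: derivative_eq_intros d1)
    then show "\<exists>y. ((\<lambda>t. \<phi> (x + t *\<^sub>R e) - grad x \<bullet> e * t - B / 2 * t\<^sup>2) has_real_derivative y) (at s) \<and> y \<le> 0"
      using g[OF s] by (intro exI conjI) auto
  qed simp
  then show ?thesis by simp
qed

text \<open>Convexity bounds the difference quotient towards \<open>x\<close> by
  \<open>\<phi> x - \<phi> 0\<close>; its limit at 0 is the vanishing directional
  derivative.\<close>

lemma convex_on_ge_of_zero_gderiv: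
  assumes "convex_on D \<phi>" "0 \<in> D" "GDERIV \<phi> 0 :> 0" "x \<in> D"
  shows "\<phi> 0 \<le> \<phi> x"
proof -
  have inner: "((\<lambda>t. t *\<^sub>R x) has_derivative (\<lambda>s. s *\<^sub>R x)) (at (0::real))"
    by (auto intro!: derivative_eq_intros)
  have outer: "(\<phi> has_derivative (\<lambda>h. 0)) (at (0 *\<^sub>R x))"
    using assms(3) by (simp add: gderiv_def)
  from has_derivative_compose[OF inner outer]
  have "((\<lambda>t. \<phi> (t *\<^sub>R x)) has_real_derivative 0) (at 0)"
    unfolding has_field_derivative_def by (rule has_derivative_eq_rhs) (simp add: fun_eq_iff)
  then have lim: "((\<lambda>t. (\<phi> (t *\<^sub>R x) - \<phi> 0) / t) \<longlongrightarrow> 0) (at_right 0)"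
    by (simp add: has_field_derivative_iff filterlim_at_split)
  have "eventually (\<lambda>t. t \<in> {0<..<1}) (at_right (0::real))"
    by (intro eventually_at_right_real) simp
  then have "eventually (\<lambda>t. (\<phi> (t *\<^sub>R x) - \<phi> 0) / t \<le> \<phi> x - \<phi> 0) (at_right 0)"
  proof eventually_elim
    case (elim t)
    then have "\<phi> (t *\<^sub>R x) \<le> (1 - t) * \<phi> 0 + t * \<phi> x"
      using convex_onD[OF assms(1), of t 0 x] assms(2,4) by simp
    then show ?case using elim by (simp add: field_simps)
  qed
  from tendsto_upperbound[OF lim this] show ?thesis by simp
qed

text \<open>As \<open>\<phi>\<close> exceeds \<open>N\<close> on the frontier, the region
  \<open>\<phi> h \<le> N h\<close> is a compact subset of the interior and keeps a uniform distance
  from the boundary. This distance supplies \<open>r\<close>.\<close>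

lemma smoothing_kernel_of_barrier:
  fixes \<phi> :: "real^'n \<Rightarrow> real"
  assumes "is_norm N" "M > 0"
    and D: "convex_on D \<phi>" and diff: "twice_cont_diff_on D \<phi> grad hess"
    and G: "compact G" "convex G" "G \<subseteq> D"
    and zero: "0 \<in> D" "\<phi> 0 = 0" "grad 0 = 0" "0 \<in> interior G"
    and frontier: "\<And>x. x \<in> frontier G \<Longrightarrow> \<phi> x > N x"
    and hess: "\<And>e h. h \<in> G \<Longrightarrow> e \<bullet> (hess h *v e) \<le> M * (N e)\<^sup>2"
    and sup: "(SUP h\<in>G. N h) \<le> \<rho>"
  obtains r where "smoothing_kernel N G \<phi> grad \<rho> r M"
proof -
  interpret finite_dim_norm N by (rule finite_dim_norm.intro[OF assms(1)])
  have der: "GDERIV \<phi> x :> grad x" if "x \<in> D" for x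
    using diff that by (auto simp: twice_cont_diff_on_def)
  have cont: "continuous_on G \<phi>"
    using der G(3) has_derivative_continuous unfolding gderiv_def
    by (meson continuous_at_imp_continuous_on subsetD)
  let ?K = "{h \<in> G. \<phi> h \<le> N h}"
  have "closed ?K"
    by (intro continuous_on_closed_Collect_le compact_imp_closed G(1) cont continuous_on_N)
  moreover have "bounded ?K"
    by (rule bounded_subset[OF compact_imp_bounded[OF G(1)]]) auto
  ultimately have "compact ?K" by (simp add: compact_eq_bounded_closed)
  moreover have "?K \<subseteq> interior G"
    using frontier closure_subset[of G] by (force simp: frontier_def)
  ultimately obtain \<epsilon> where \<epsilon>: "\<epsilon> > 0" "(\<Union>x\<in>?K. ball x \<epsilon>) \<subseteq> interior G"
    using compact_subset_open_imp_ball_epsilon_subset[OF _ open_interior] by blast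
  obtain c where c: "c > 0" "\<And>x. norm x \<le> c * N x" using norm_le_N by blast
  \<comment> \<open>The factor 2 makes the estimate strict, as the open ball requires.\<close>
  define r where "r = \<epsilon> / (2 * c)"
  have shift: "h - e \<in> G" if "h \<in> G" "\<phi> h \<le> N h" "N e \<le> r" for h e
  proof -
    have "norm e \<le> c * N e" by (rule c(2))
    also have "\<dots> \<le> c * r" using c(1) that(3) by simp
    also have "\<dots> < \<epsilon>" using c(1) \<epsilon>(1) by (simp add: r_def)
    finally have "h - e \<in> ball h \<epsilon>" by (simp add: dist_norm)
    then show ?thesis using \<epsilon>(2) that interior_subset by blast
  qed
  have "smoothing_kernel N G \<phi> grad \<rho> r M"
  proof unfold_locales
    show "convex_on G \<phi>" using D G by (rule_tac convex_on_subset)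
    show "0 \<in> G" using zero(4) interior_subset by blast
    show "0 \<le> \<phi> h" if "h \<in> G" for h
      using convex_on_ge_of_zero_gderiv[OF D zero(1), of h] der[OF zero(1)] zero that G(3) by auto
    show "N h \<le> \<rho>" if "h \<in> G" for h
    proof -
      have "bdd_above (N ` G)"
        by (intro bounded_imp_bdd_above compact_imp_bounded compact_continuous_image
            continuous_on_N G(1))
      then show ?thesis using cSUP_upper[OF that, of N] sup by simp
    qed
    show "\<phi> (h - e) \<le> \<phi> h - grad h \<bullet> e + M / 2 * (N e)\<^sup>2"
      if "h \<in> G" "\<phi> h \<le> N h" "N e \<le> r" for h e
      using second_order_upper_bound[OF diff G(2,3), of "- e" "M * (N (- e))\<^sup>2" h, OF hess] shift[OF that] that(1) by simp
  qed (use assms(2) G(1) cont zero(2) shift \<epsilon>(1) c(1) in \<open>auto simp: r_def\<close>)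
  then show thesis by (rule that)
qed

section \<open>The resisting oracle\<close>

text \<open>Entries are pairs of index and sign in order of selection, so prefixes represent what
  the oracle has committed to. For the empty list \<open>Max\<close> is unspecified, hence the
  nonemptiness conditions below.\<close>

definition signed_max :: "(nat \<Rightarrow> 'a::real_inner) \<Rightarrow> real \<Rightarrow> (nat \<times> real) list \<Rightarrow> 'a \<Rightarrow> real" where
  "signed_max \<omega> \<delta> ls x =
     (MAX k\<in>{..<length ls}. snd (ls ! k) * (\<omega> (fst (ls ! k)) \<bullet> x) - real k * \<delta>)"

lemma signed_max_ge:
  "k < length ls \<Longrightarrow> snd (ls ! k) * (\<omega> (fst (ls ! k)) \<bullet> x) - real k * \<delta> \<le> signed_max \<omega> \<delta> ls x"
  unfolding signed_max_def by (intro Max_ge) auto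

lemma signed_max_le:
  assumes "ls \<noteq> []"
    and "\<And>k. k < length ls \<Longrightarrow> snd (ls ! k) * (\<omega> (fst (ls ! k)) \<bullet> x) - real k * \<delta> \<le> c"
  shows "signed_max \<omega> \<delta> ls x \<le> c"
  unfolding signed_max_def using assms by (intro Max.boundedI) auto

lemma convex_signed_max:
  assumes "ls \<noteq> []" shows "convex_on UNIV (signed_max \<omega> \<delta> ls)"
proof (rule convex_onI)
  fix t :: real and x y
  assume t: "0 < t" "t < 1"
  show "signed_max \<omega> \<delta> ls ((1 - t) *\<^sub>R x + t *\<^sub>R y)
      \<le> (1 - t) * signed_max \<omega> \<delta> ls x + t * signed_max \<omega> \<delta> ls y"
  proof (rule signed_max_le[OF assms])
    fix k assume k: "k < length ls"
    let ?l = "\<lambda>x. snd (ls ! k) * (\<omega> (fst (ls ! k)) \<bullet> x) - real k * \<delta>"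
    have "?l ((1 - t) *\<^sub>R x + t *\<^sub>R y) = (1 - t) * ?l x + t * ?l y"
      by (simp add: inner_simps algebra_simps)
    also have "\<dots> \<le> (1 - t) * signed_max \<omega> \<delta> ls x + t * signed_max \<omega> \<delta> ls y"
      using t by (intro add_mono mult_left_mono signed_max_ge k) auto
    finally show "?l ((1 - t) *\<^sub>R x + t *\<^sub>R y)
      \<le> (1 - t) * signed_max \<omega> \<delta> ls x + t * signed_max \<omega> \<delta> ls y" .
  qed
qed simp

definition sign_choices :: "nat \<Rightarrow> (nat \<times> real) list \<Rightarrow> bool" where
  "sign_choices T ls \<longleftrightarrow> distinct (map fst ls) \<and> set ls \<subseteq> {1..T} \<times> {-1, 1}"

lemma sign_choices_nth:
  assumes "sign_choices T ls" "k < length ls"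
  shows "fst (ls ! k) \<in> {1..T}" "snd (ls ! k) \<in> {-1, 1}"
proof -
  have "ls ! k \<in> {1..T} \<times> {-1, 1}"
    using assms nth_mem[of k ls] unfolding sign_choices_def by blast
  then show "fst (ls ! k) \<in> {1..T}" "snd (ls ! k) \<in> {-1, 1}" by (simp_all add: mem_Times_iff)
qed

lemma (in finite_dim_norm) nonexpansive_signed_max:
  assumes \<omega>: "\<And>i x. i \<in> {1..T} \<Longrightarrow> \<bar>\<omega> i \<bullet> x\<bar> \<le> N x"
    and ls: "sign_choices T ls" "ls \<noteq> []"
  shows "nonexpansive (signed_max \<omega> \<delta> ls)"
proof -
  have "signed_max \<omega> \<delta> ls x \<le> signed_max \<omega> \<delta> ls y + N (x - y)" for x y
  proof (rule signed_max_le[OF ls(2)])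
    fix k assume k: "k < length ls"
    have "snd (ls ! k) * (\<omega> (fst (ls ! k)) \<bullet> (x - y)) \<le> N (x - y)"
      using \<omega>[of "fst (ls ! k)" "x - y"] sign_choices_nth[OF ls(1) k] by auto
    then show "snd (ls ! k) * (\<omega> (fst (ls ! k)) \<bullet> x) - real k * \<delta> \<le> signed_max \<omega> \<delta> ls y + N (x - y)"
      using signed_max_ge[OF k, of \<omega> y \<delta>] by (simp add: inner_simps algebra_simps)
  qed
  then show ?thesis by (simp add: nonexpansive_def algebra_simps)
qed

definition dominates :: "nat \<Rightarrow> (nat \<Rightarrow> 'a::real_inner) \<Rightarrow> 'a \<Rightarrow> (nat \<times> real) list \<Rightarrow> nat \<times> real \<Rightarrow> bool" where
  "dominates T \<omega> x ls c \<longleftrightarrow>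
     (\<forall>i\<in>{1..T} - fst ` set ls. \<bar>\<omega> i \<bullet> x\<bar> \<le> snd c * (\<omega> (fst c) \<bullet> x))"

lemma exists_dominating:
  assumes ls: "sign_choices T ls" and "length ls < T"
  obtains c where "sign_choices T (ls @ [c])" "dominates T \<omega> x ls c"
proof -
  let ?I = "{1..T} - fst ` set ls"
  have "card (fst ` set ls) = length ls"
    using ls by (metis distinct_card length_map set_map sign_choices_def)
  then have "\<not> {1..T} \<subseteq> fst ` set ls"
    using card_mono[of "fst ` set ls" "{1..T}"] assms(2) by auto
  then have "?I \<noteq> {}" by blast
  let ?M = "Max ((\<lambda>i. \<bar>\<omega> i \<bullet> x\<bar>) ` ?I)"
  have "?M \<in> (\<lambda>i. \<bar>\<omega> i \<bullet> x\<bar>) ` ?I"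
    using \<open>?I \<noteq> {}\<close> by (intro Max_in) auto
  then obtain j where j: "j \<in> ?I" "\<bar>\<omega> j \<bullet> x\<bar> = ?M" by auto
  then have j_max: "\<bar>\<omega> i \<bullet> x\<bar> \<le> \<bar>\<omega> j \<bullet> x\<bar>" if "i \<in> ?I" for i
    using Max_ge[of "(\<lambda>i. \<bar>\<omega> i \<bullet> x\<bar>) ` ?I" "\<bar>\<omega> i \<bullet> x\<bar>"] that by auto
  define s :: real where "s = (if \<omega> j \<bullet> x \<ge> 0 then 1 else -1)"
  show thesis
  proof (rule that[of "(j, s)"])
    show "sign_choices T (ls @ [(j, s)])"
      using ls j(1) by (auto simp: sign_choices_def s_def)
    show "dominates T \<omega> x ls (j, s)"
      using j_max by (auto simp: dominates_def s_def)
  qed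
qed

text \<open>The offsets \<open>k \<delta>\<close> give the term chosen as dominating at \<open>x\<close> a lead of at least \<open>\<delta>\<close>
  over every term chosen later, and two terms drift apart by at most \<open>2 N (y - x)\<close>.\<close>

lemma (in finite_dim_norm) signed_max_agree:
  assumes \<omega>: "\<And>i x. i \<in> {1..T} \<Longrightarrow> \<bar>\<omega> i \<bullet> x\<bar> \<le> N x" and "\<delta> \<ge> 0"
    and valid: "sign_choices T (ls @ c # u)" and dom: "dominates T \<omega> x ls c"
    and y: "2 * N (y - x) \<le> \<delta>"
  shows "signed_max \<omega> \<delta> (ls @ c # u) y = signed_max \<omega> \<delta> (ls @ [c]) y"
proof (rule antisym)
  let ?n = "length ls"
  let ?l = "\<lambda>k x. snd ((ls @ c # u) ! k) * (\<omega> (fst ((ls @ c # u) ! k)) \<bullet> x)"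
  have prefix: "(ls @ c # u) ! k = (ls @ [c]) ! k" if "k < Suc ?n" for k
    using that by (auto simp: nth_append less_Suc_eq)
  have short: "?l k y - real k * \<delta> \<le> signed_max \<omega> \<delta> (ls @ [c]) y" if "k < Suc ?n" for k
    using signed_max_ge[of k "ls @ [c]" \<omega> y \<delta>] that prefix[OF that] by simp
  have drift: "\<bar>?l k y - ?l k x\<bar> \<le> N (y - x)" if "k < length (ls @ c # u)" for k
    using \<omega>[OF sign_choices_nth(1)[OF valid that], of "y - x"] sign_choices_nth(2)[OF valid that]
    by (auto simp: inner_diff_right)
  show "signed_max \<omega> \<delta> (ls @ c # u) y \<le> signed_max \<omega> \<delta> (ls @ [c]) y"
  proof (rule signed_max_le)
    fix k assume k: "k < length (ls @ c # u)"
    show "?l k y - real k * \<delta> \<le> signed_max \<omega> \<delta> (ls @ [c]) y"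
    proof (cases "k < Suc ?n")
      case False
      define d where "d = (ls @ c # u) ! k"
      have "d \<in> set u" using False k by (auto simp: d_def nth_append nth_Cons')
      then have "fst d \<notin> fst ` set ls" using valid by (auto simp: sign_choices_def)
      then have "\<bar>\<omega> (fst d) \<bullet> x\<bar> \<le> snd c * (\<omega> (fst c) \<bullet> x)"
        using dom sign_choices_nth(1)[OF valid k] by (auto simp: dominates_def d_def)
      then have "?l k x \<le> ?l ?n x"
        using sign_choices_nth(2)[OF valid k] by (auto simp: d_def)
      moreover have "real (Suc ?n) * \<delta> \<le> real k * \<delta>"
        using False \<open>\<delta> \<ge> 0\<close> by (intro mult_right_mono) auto
      moreover have "real (Suc ?n) * \<delta> = real ?n * \<delta> + \<delta>" by (simp add: algebra_simps)
      ultimately show ?thesis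
        using drift[OF k] drift[of ?n] short[of ?n] y by simp
    qed (rule short)
  qed simp
  show "signed_max \<omega> \<delta> (ls @ [c]) y \<le> signed_max \<omega> \<delta> (ls @ c # u) y"
  proof (rule signed_max_le)
    fix k assume "k < length (ls @ [c])"
    then show "snd ((ls @ [c]) ! k) * (\<omega> (fst ((ls @ [c]) ! k)) \<bullet> y) - real k * \<delta>
        \<le> signed_max \<omega> \<delta> (ls @ c # u) y"
      using signed_max_ge[of k "ls @ c # u" \<omega> y \<delta>] prefix[of k] by simp
  qed simp
qed

lemma local_oracleD:
  assumes "local_oracle \<F> Orc" "f \<in> \<F>" "g \<in> \<F>" "open U" "x \<in> U" "\<And>y. y \<in> U \<Longrightarrow> f y = g y"
  shows "Orc f x = Orc g x"
  using assms unfolding local_oracle_def by blast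

text \<open>The first \<open>t\<close> queries are answered before the later signs and indices are fixed:
  by locality, every continuation of the list of choices is consistent with the answers.\<close>

lemma resisting_oracle:
  fixes Orc :: "(real^'n \<Rightarrow> real) \<Rightarrow> real^'n \<Rightarrow> 'i" and R :: "('n, 'i) search_rules"
  assumes orc: "local_oracle \<F> Orc"
    and F: "\<And>ls. sign_choices T ls \<Longrightarrow> ls \<noteq> [] \<Longrightarrow> F ls \<in> \<F>"
    and agree: "\<And>ls c u x. sign_choices T (ls @ c # u) \<Longrightarrow> dominates T \<omega> x ls c \<Longrightarrow>
      \<exists>U. open U \<and> x \<in> U \<and> (\<forall>y\<in>U. F (ls @ c # u) y = F (ls @ [c]) y)"
    and "t < T"
  shows "\<exists>ls h. length ls = t \<and> sign_choices T ls \<and>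
    (\<forall>u. u \<noteq> [] \<longrightarrow> sign_choices T (ls @ u) \<longrightarrow> history R Orc (F (ls @ u)) t = h)"
  using \<open>t < T\<close>
proof (induction t)
  case 0
  show ?case by (intro exI[of _ "[]"]) (auto simp: sign_choices_def)
next
  case (Suc t)
  then obtain ls h where ls: "length ls = t" "sign_choices T ls"
    and h: "\<And>u. u \<noteq> [] \<Longrightarrow> sign_choices T (ls @ u) \<Longrightarrow> history R Orc (F (ls @ u)) t = h"
    by auto
  \<comment> \<open>All nonempty continuations share the history \<open>h\<close>, so the next query
    is known before \<open>c\<close> is selected. \<open>F []\<close> need not lie in the family,
    hence \<open>u \<noteq> []\<close>.\<close>
  let ?x = "R (Suc t) h"
  obtain c where c: "sign_choices T (ls @ [c])" "dominates T \<omega> ?x ls c"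
    using exists_dominating[OF ls(2)] ls(1) Suc.prems by (metis Suc_lessD)
  show ?case
  proof (intro exI conjI allI impI)
    show "length (ls @ [c]) = Suc t" using ls(1) by simp
    show "sign_choices T (ls @ [c])" by (fact c(1))
    fix u assume u: "u \<noteq> []" "sign_choices T ((ls @ [c]) @ u)"
    then have valid: "sign_choices T (ls @ c # u)" by simp
    obtain U where "open U" "?x \<in> U" "\<And>y. y \<in> U \<Longrightarrow> F (ls @ c # u) y = F (ls @ [c]) y"
      using agree[OF valid c(2)] by blast
    \<comment> \<open>The right-hand side does not mention \<open>u\<close>: this answer is common
      to all continuations.\<close>
    then have "Orc (F (ls @ c # u)) ?x = Orc (F (ls @ [c])) ?x"
      using valid c(1) by (intro local_oracleD[OF orc F F]) auto
    then show "history R Orc (F ((ls @ [c]) @ u)) (Suc t) = h @ [(?x, Orc (F (ls @ [c])) ?x)]"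
      using h[OF _ valid] by (simp add: Let_def)
  qed
qed

section \<open>Hoelder smoothness and assembly of the lower bound\<close>

text \<open>Interpolation: the exponent is split as
  \<open>1 = (2 - \<kappa>) + (\<kappa> - 1)\<close>, and the minimum of \<open>u\<close> and 2 is
  bounded by 2 in the first factor and by \<open>u\<close> in the second.\<close>

lemma min_two_le_powr:
  fixes u \<kappa> z :: real
  assumes "0 \<le> u" "z \<le> u" "z \<le> 2" "1 < \<kappa>" "\<kappa> \<le> 2"
  shows "z \<le> 2 powr (2 - \<kappa>) * u powr (\<kappa> - 1)"
proof (cases "u \<le> 2")
  case True
  have "z \<le> u powr ((2 - \<kappa>) + (\<kappa> - 1))" using assms by simp
  also have "\<dots> = u powr (2 - \<kappa>) * u powr (\<kappa> - 1)" by (rule powr_add)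
  also have "\<dots> \<le> 2 powr (2 - \<kappa>) * u powr (\<kappa> - 1)"
    using True assms by (intro mult_right_mono powr_mono2) auto
  finally show ?thesis .
next
  case False
  have "z \<le> 2 powr ((2 - \<kappa>) + (\<kappa> - 1))" using assms by simp
  also have "\<dots> = 2 powr (2 - \<kappa>) * 2 powr (\<kappa> - 1)" by (rule powr_add)
  also have "\<dots> \<le> 2 powr (2 - \<kappa>) * u powr (\<kappa> - 1)"
    using False assms by (intro mult_left_mono powr_mono2) auto
  finally show ?thesis .
qed

text \<open>Interpolating the Lipschitz bound and the bound 2 gives the Hoelder constant
  \<open>2 powr (2 - \<kappa>) * A powr (\<kappa> - 1)\<close>; the factor \<open>a\<close>
  normalizes it to \<open>L\<close>.\<close>

lemma scaled_smoothing_in_smooth_family: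
  fixes N :: "real^'n \<Rightarrow> real"
  assumes kernel: "smoothing_kernel N H \<Psi> p \<rho> r A" and "A > 0"
    and f: "finite_dim_norm.nonexpansive N f" "convex_on UNIV f"
    and "L > 0" "1 < \<kappa>" "\<kappa> \<le> 2"
    and a: "a = L / (2 powr (2 - \<kappa>) * A powr (\<kappa> - 1))"
  shows "(\<lambda>x. a * smoothing_kernel.smoothing H \<Psi> f x) \<in> smooth_family N \<kappa> L"
proof -
  interpret smoothing_kernel N H \<Psi> p \<rho> r A by (rule kernel)
  have "a > 0" using assms by simp
  have conv: "convex_on UNIV (\<lambda>x. a * smoothing f x)"
    using \<open>a > 0\<close> by (intro convex_on_cmul convex_smoothing f) simp
  have der: "GDERIV (\<lambda>x. a * smoothing f x) x :> a *\<^sub>R smoothing_grad f x" for x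
    using has_derivative_mult_right[OF gderiv_smoothing[OF f, unfolded gderiv_def], of a]
    by (simp add: gderiv_def)
  have cont: "continuous_on UNIV (\<lambda>x. a *\<^sub>R smoothing_grad f x)"
    by (intro continuous_intros continuous_smoothing_grad f)
  have "dual_norm N (a *\<^sub>R smoothing_grad f x - a *\<^sub>R smoothing_grad f y) \<le> L * N (x - y) powr (\<kappa> - 1)"
    for x y
  proof (rule dual_norm_leI[OF is_norm])
    fix v assume v: "N v \<le> 1"
    let ?z = "(smoothing_grad f x - smoothing_grad f y) \<bullet> v"
    have "?z \<le> 2 powr (2 - \<kappa>) * (A * N (x - y)) powr (\<kappa> - 1)"
      using assms smoothing_grad_lipschitz[OF f v] smoothing_grad_diff_le[OF f v]
      by (intro min_two_le_powr) auto
    also have "\<dots> = 2 powr (2 - \<kappa>) * A powr (\<kappa> - 1) * N (x - y) powr (\<kappa> - 1)"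
      using \<open>A > 0\<close> by (simp add: powr_mult)
    finally have "a * ?z \<le> a * (2 powr (2 - \<kappa>) * A powr (\<kappa> - 1) * N (x - y) powr (\<kappa> - 1))"
      using \<open>a > 0\<close> by (intro mult_left_mono) auto
    also have "\<dots> = L * N (x - y) powr (\<kappa> - 1)"
      using \<open>A > 0\<close> by (simp add: a)
    finally show "(a *\<^sub>R smoothing_grad f x - a *\<^sub>R smoothing_grad f y) \<bullet> v
        \<le> L * N (x - y) powr (\<kappa> - 1)"
      by (simp add: inner_simps algebra_simps)
  qed
  then show ?thesis
    unfolding smooth_family_def
    by (intro CollectI conjI conv exI[of _ "\<lambda>x. a *\<^sub>R smoothing_grad f x"] allI der cont)
qed

text \<open>Dropping the offsets and adding the terms of unselected indices can only raise the
  maximum, so \<open>c\<close> lies below a min-max value covered by the assumption.\<close>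

lemma signed_max_Inf_le:
  assumes ls: "sign_choices T ls" "ls \<noteq> []" and "T > 0" "\<delta> \<ge> 0" "X \<noteq> {}"
    and "\<And>\<xi> :: nat \<Rightarrow> real. (\<forall>i\<in>{1..T}. \<xi> i \<in> {-1, 1}) \<Longrightarrow>
      (INF x\<in>X. MAX i\<in>{1..T}. \<xi> i * (\<omega> i \<bullet> x)) \<le> - \<Delta>"
    and lower: "\<And>x. x \<in> X \<Longrightarrow> c \<le> signed_max \<omega> \<delta> ls x"
  shows "c \<le> - \<Delta>"
proof -
  \<comment> \<open>Unselected indices receive the arbitrary sign 1.\<close>
  define \<xi> where "\<xi> i = (case map_of ls i of Some s \<Rightarrow> s | None \<Rightarrow> 1)" for i
  have "\<xi> i \<in> {-1, 1}" for i
  proof (cases "map_of ls i")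
    case (Some s)
    then have "(i, s) \<in> set ls" by (rule map_of_SomeD)
    then show ?thesis using ls(1) Some by (auto simp: \<xi>_def sign_choices_def)
  qed (simp add: \<xi>_def)
  then have "(INF x\<in>X. MAX i\<in>{1..T}. \<xi> i * (\<omega> i \<bullet> x)) \<le> - \<Delta>" by (intro assms) simp
  moreover have "c \<le> (INF x\<in>X. MAX i\<in>{1..T}. \<xi> i * (\<omega> i \<bullet> x))"
  proof (rule cINF_greatest[OF \<open>X \<noteq> {}\<close>])
    fix x assume "x \<in> X"
    then have "c \<le> signed_max \<omega> \<delta> ls x" by (rule lower)
    also have "\<dots> \<le> (MAX i\<in>{1..T}. \<xi> i * (\<omega> i \<bullet> x))"
    proof (rule signed_max_le[OF ls(2)])
      fix k assume k: "k < length ls"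
      have "map_of ls (fst (ls ! k)) = Some (snd (ls ! k))"
        using ls(1) k by (intro map_of_is_SomeI) (auto simp: sign_choices_def)
      then have "snd (ls ! k) = \<xi> (fst (ls ! k))" by (simp add: \<xi>_def)
      moreover have "\<xi> (fst (ls ! k)) * (\<omega> (fst (ls ! k)) \<bullet> x) \<le> (MAX i\<in>{1..T}. \<xi> i * (\<omega> i \<bullet> x))"
        using sign_choices_nth(1)[OF ls(1) k] by (intro Max_ge) auto
      ultimately show "snd (ls ! k) * (\<omega> (fst (ls ! k)) \<bullet> x) - real k * \<delta>
          \<le> (MAX i\<in>{1..T}. \<xi> i * (\<omega> i \<bullet> x))"
        using mult_nonneg_nonneg[OF of_nat_0_le_iff \<open>\<delta> \<ge> 0\<close>, of k] by (simp only:)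
    qed
    finally show "c \<le> (MAX i\<in>{1..T}. \<xi> i * (\<omega> i \<bullet> x))" .
  qed
  ultimately show ?thesis by simp
qed

text \<open>The strict inequality \<open>2 * \<rho> < \<delta>\<close> leaves room for an open
  neighbourhood of \<open>x\<close> whose points, shifted by \<open>H\<close>, still fall where the
  two maxima agree.\<close>

lemma (in smoothing_kernel) smoothing_signed_max_agree:
  assumes \<omega>: "\<And>i x. i \<in> {1..T} \<Longrightarrow> \<bar>\<omega> i \<bullet> x\<bar> \<le> N x" and \<delta>: "2 * \<rho> < \<delta>" "\<delta> \<ge> 0"
    and valid: "sign_choices T (ls @ c # u)" and dom: "dominates T \<omega> x ls c"
  shows "\<exists>U. open U \<and> x \<in> U \<and> (\<forall>y\<in>U. smoothing (signed_max \<omega> \<delta> (ls @ c # u)) y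
    = smoothing (signed_max \<omega> \<delta> (ls @ [c])) y)"
proof (intro exI conjI ballI)
  let ?U = "{y. 2 * (N (y - x) + \<rho>) < \<delta>}"
  show "open ?U"
    by (intro open_Collect_less continuous_intros continuous_on_compose2[OF continuous_on_N]) auto
  show "x \<in> ?U" using \<delta> by simp
  fix y assume y: "y \<in> ?U"
  have "signed_max \<omega> \<delta> (ls @ c # u) (y + h) = signed_max \<omega> \<delta> (ls @ [c]) (y + h)" if "h \<in> H" for h
  proof -
    have "N (y + h - x) \<le> N (y - x) + \<rho>"
      using N_triangle[of "y - x" h] N_le_\<rho>[OF that] by (simp add: algebra_simps)
    then show ?thesis
      using y by (intro signed_max_agree[OF \<omega> \<delta>(2) valid dom]) auto
  qed
  then show "smoothing (signed_max \<omega> \<delta> (ls @ c # u)) y = smoothing (signed_max \<omega> \<delta> (ls @ [c])) y"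
    by (rule smoothing_cong)
qed

text \<open>Smoothing never raises a function, so the infimum divided by \<open>a\<close> is a lower
  bound of \<open>signed_max\<close> on \<open>X\<close>.\<close>

lemma (in smoothing_kernel) Inf_smoothing_signed_max_le:
  assumes \<omega>: "\<And>i x. i \<in> {1..T} \<Longrightarrow> \<bar>\<omega> i \<bullet> x\<bar> \<le> N x" and "T > 0" "\<delta> \<ge> 0" "a > 0"
    and X: "compact X" "X \<noteq> {}"
    and Inf_le: "\<And>\<xi> :: nat \<Rightarrow> real. (\<forall>i\<in>{1..T}. \<xi> i \<in> {-1, 1}) \<Longrightarrow>
      (INF x\<in>X. MAX i\<in>{1..T}. \<xi> i * (\<omega> i \<bullet> x)) \<le> - \<Delta>"
    and ls: "sign_choices T ls" "ls \<noteq> []"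
  shows "(INF x\<in>X. a * smoothing (signed_max \<omega> \<delta> ls) x) \<le> - (a * \<Delta>)"
proof -
  let ?f = "signed_max \<omega> \<delta> ls" and ?F = "\<lambda>x. a * smoothing (signed_max \<omega> \<delta> ls) x"
  have f: "nonexpansive ?f" by (rule nonexpansive_signed_max[OF \<omega> ls])
  have "continuous_on X ?F"
    by (intro continuous_intros continuous_on_nonexpansive nonexpansive_smoothing f)
  then have bdd: "bdd_below (?F ` X)"
    using X(1) by (intro bounded_imp_bdd_below compact_imp_bounded compact_continuous_image)
  have "(INF x\<in>X. ?F x) / a \<le> - \<Delta>"
  proof (rule signed_max_Inf_le[OF ls \<open>T > 0\<close> \<open>\<delta> \<ge> 0\<close> X(2) Inf_le])
    fix y assume "y \<in> X"
    then have "(INF x\<in>X. ?F x) \<le> ?F y" by (intro cINF_lower bdd)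
    also have "\<dots> \<le> a * ?f y"
      using \<open>a > 0\<close> smoothing_upper[OF f] by (intro mult_left_mono) auto
    finally show "(INF x\<in>X. ?F x) / a \<le> ?f y"
      using \<open>a > 0\<close> by (simp add: divide_le_eq mult.commute)
  qed
  then show ?thesis using \<open>a > 0\<close> by (simp add: divide_le_eq mult.commute)
qed

lemma lower_bound_of_kernel:
  fixes N :: "real^'n \<Rightarrow> real" and R :: "('n, 'i) search_rules"
  assumes kernel: "smoothing_kernel N H \<Psi> p \<rho> r A" and "A > 0"
    and \<omega>: "\<And>i x. i \<in> {1..T} \<Longrightarrow> \<bar>\<omega> i \<bullet> x\<bar> \<le> N x"
    and Inf_le: "\<And>\<xi> :: nat \<Rightarrow> real. (\<forall>i\<in>{1..T}. \<xi> i \<in> {-1, 1}) \<Longrightarrow>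
      (INF x\<in>X. MAX i\<in>{1..T}. \<xi> i * (\<omega> i \<bullet> x)) \<le> - \<Delta>"
    and X: "compact X" "X \<noteq> {}" and "T > 0" and \<delta>: "2 * \<rho> < \<delta>" "\<delta> \<ge> 0"
    and "L > 0" "1 < \<kappa>" "\<kappa> \<le> 2" and orc: "local_oracle (smooth_family N \<kappa> L) Orc"
    and a: "a = L / (2 powr (2 - \<kappa>) * A powr (\<kappa> - 1))"
  shows "\<exists>f\<in>smooth_family N \<kappa> L.
    f (search_point R Orc f T) - (INF x\<in>X. f x) \<ge> a * (\<Delta> - \<rho> - real (T - 1) * \<delta>)"
proof -
  interpret smoothing_kernel N H \<Psi> p \<rho> r A by (rule kernel)
  have "a > 0" using \<open>A > 0\<close> \<open>L > 0\<close> by (simp add: a)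
  define F where "F ls x = a * smoothing (signed_max \<omega> \<delta> ls) x" for ls x
  have F: "F ls \<in> smooth_family N \<kappa> L" if "sign_choices T ls" "ls \<noteq> []" for ls
    unfolding F_def
    by (rule scaled_smoothing_in_smooth_family[OF kernel \<open>A > 0\<close>
        nonexpansive_signed_max[OF \<omega> that] convex_signed_max[OF that(2)]
        \<open>L > 0\<close> \<open>1 < \<kappa>\<close> \<open>\<kappa> \<le> 2\<close> a])
  have agree: "\<exists>U. open U \<and> x \<in> U \<and> (\<forall>y\<in>U. F (ls @ c # u) y = F (ls @ [c]) y)"
    if valid: "sign_choices T (ls @ c # u)" and dom: "dominates T \<omega> x ls c" for ls c u x
    using smoothing_signed_max_agree[OF \<omega> \<delta> valid dom] unfolding F_def by metis
  have "T - 1 < T" using \<open>T > 0\<close> by simp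
  obtain ls h where ls: "length ls = T - 1" "sign_choices T ls"
    and h: "\<And>u. u \<noteq> [] \<Longrightarrow> sign_choices T (ls @ u) \<Longrightarrow> history R Orc (F (ls @ u)) (T - 1) = h"
    using resisting_oracle[where F = F and R = R and \<omega> = \<omega>, OF orc F agree \<open>T - 1 < T\<close>] by auto
  define x where "x = R T h"
  \<comment> \<open>The final point is already fixed by \<open>h\<close>, so the last entry can be
    selected there: its term is nonnegative and only the offset
    \<open>real (T - 1) * \<delta>\<close> is lost.\<close>
  obtain c where c: "sign_choices T (ls @ [c])" "dominates T \<omega> x ls c"
    using exists_dominating[OF ls(2)] \<open>T - 1 < T\<close> unfolding ls(1) by metis
  let ?g = "ls @ [c]"
  have x: "search_point R Orc (F ?g) T = x"
    using h[OF _ c(1)] by (simp add: search_point_def x_def)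
  have "fst c \<in> {1..T} - fst ` set ls"
    using c(1) by (auto simp: sign_choices_def)
  then have "0 \<le> snd c * (\<omega> (fst c) \<bullet> x)"
    using c(2) unfolding dominates_def by (metis abs_ge_zero order_trans)
  then have "- (real (T - 1) * \<delta>) \<le> signed_max \<omega> \<delta> ?g x"
    unfolding ls(1)[symmetric] using signed_max_ge[of "length ls" ?g \<omega> x \<delta>] by simp
  also have "\<dots> - \<rho> \<le> smoothing (signed_max \<omega> \<delta> ?g) x"
    by (rule smoothing_lower[OF nonexpansive_signed_max[OF \<omega> c(1)]]) simp_all
  finally have "a * (- (real (T - 1) * \<delta>) - \<rho>) \<le> F ?g x"
    unfolding F_def using \<open>a > 0\<close> by (intro mult_left_mono) auto
  moreover have "(INF x\<in>X. F ?g x) \<le> - (a * \<Delta>)"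
    unfolding F_def
    by (rule Inf_smoothing_signed_max_le[OF \<omega> \<open>T > 0\<close> \<delta>(2) \<open>a > 0\<close> X Inf_le c(1)]) simp_all
  ultimately have "F ?g (search_point R Orc (F ?g) T) - (INF x\<in>X. F ?g x)
      \<ge> a * (\<Delta> - \<rho> - real (T - 1) * \<delta>)"
    unfolding x by (simp add: algebra_simps)
  then show ?thesis using F[OF c(1)] by blast
qed

text \<open>The right-hand side is the scale factor for curvature \<open>M / \<theta>\<close> with
  \<open>\<theta> = \<Delta> / (4 * T * \<rho>)\<close>, times the guaranteed gap
  \<open>\<Delta> / 2\<close>.\<close>

lemma bound_constant_eq:
  fixes \<Delta> \<rho> M L \<kappa> :: real
  assumes "T > 0" "\<Delta> > 0" "\<rho> > 0" "M > 0"
  shows "\<Delta> powr \<kappa> / (2 powr (\<kappa> + 1) * (\<rho> * M) powr (\<kappa> - 1)) * (L / T powr (\<kappa> - 1))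
    = L / (2 powr (2 - \<kappa>) * (M / (\<Delta> / (4 * T * \<rho>))) powr (\<kappa> - 1)) * (\<Delta> / 2)"
proof -
  have "M / (\<Delta> / (4 * T * \<rho>)) = 4 * T * (\<rho> * M) / \<Delta>" by simp
  then have 1: "(M / (\<Delta> / (4 * T * \<rho>))) powr (\<kappa> - 1)
      = 4 powr (\<kappa> - 1) * T powr (\<kappa> - 1) * (\<rho> * M) powr (\<kappa> - 1) / \<Delta> powr (\<kappa> - 1)"
    using assms by (simp add: powr_mult powr_divide)
  have "(4::real) powr (\<kappa> - 1) = (2 powr 2) powr (\<kappa> - 1)" by simp
  also have "\<dots> = 2 powr (2 * (\<kappa> - 1))" by (rule powr_powr)
  finally have "2 * (2 powr (2 - \<kappa>) * 4 powr (\<kappa> - 1)) = 2 powr 1 * (2 powr (2 - \<kappa>) * 2 powr (2 * (\<kappa> - 1)))"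
    by simp
  also have "\<dots> = 2 powr (\<kappa> + 1)" unfolding powr_add[symmetric] by (simp add: algebra_simps)
  finally have 2: "2 powr (\<kappa> + 1) = 2 * (2 powr (2 - \<kappa>) * 4 powr (\<kappa> - 1))" by simp
  have "\<Delta> powr (1 + (\<kappa> - 1)) = \<Delta> powr 1 * \<Delta> powr (\<kappa> - 1)" by (rule powr_add)
  then have 3: "\<Delta> powr \<kappa> = \<Delta> * \<Delta> powr (\<kappa> - 1)" using assms by simp
  show ?thesis unfolding 1 2 3 using assms by (simp add: field_simps)
qed

theorem proposition2:
  fixes N :: "real^'n \<Rightarrow> real" and X :: "(real^'n) set" and T :: nat
    and \<Delta> M \<rho> L \<kappa> :: real
    and Orc :: "(real^'n \<Rightarrow> real) \<Rightarrow> real^'n \<Rightarrow> 'i"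
    and R :: "('n, 'i) search_rules"
  assumes "is_norm N" and "compact X" and "convex X" and "{x. N x \<le> 1} \<subseteq> X"
    and "T > 0" and "\<Delta> > 0"
    and "\<exists>\<omega> :: nat \<Rightarrow> real^'n.
           (\<forall>i\<in>{1..T}. dual_norm N (\<omega> i) \<le> 1) \<and>
           (\<forall>\<xi> :: nat \<Rightarrow> real. (\<forall>i\<in>{1..T}. \<xi> i \<in> {-1, 1}) \<longrightarrow>
              (INF x\<in>X. MAX i\<in>{1..T}. \<xi> i * (\<omega> i \<bullet> x)) \<le> - \<Delta>)"
    and "M > 0" and "\<rho> > 0"
    and "\<exists>D \<phi> grad hess G.
           open D \<and> convex D \<and> convex_on D \<phi> \<and> twice_cont_diff_on D \<phi> grad hess \<and>
           compact G \<and> convex G \<and> G \<subseteq> D \<and>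
           0 \<in> D \<and> \<phi> 0 = 0 \<and> grad 0 = 0 \<and>
           0 \<in> interior G \<and> (\<forall>x\<in>frontier G. \<phi> x > N x) \<and>
           (\<forall>e. \<forall>h\<in>G. e \<bullet> (hess h *v e) \<le> M * (N e)\<^sup>2) \<and>
           (SUP h\<in>G. N h) \<le> \<rho>"
    and "L > 0" and "1 < \<kappa>" and "\<kappa> \<le> 2"
    and "local_oracle (smooth_family N \<kappa> L) Orc"
  shows "\<exists>f\<in>smooth_family N \<kappa> L.
           f (search_point R Orc f T) - (INF x\<in>X. f x)
             \<ge> \<Delta> powr \<kappa> / (2 powr (\<kappa> + 1) * (\<rho> * M) powr (\<kappa> - 1)) * (L / real T powr (\<kappa> - 1))"
proof -
  obtain \<omega> :: "nat \<Rightarrow> real^'n" where dual: "\<And>i. i \<in> {1..T} \<Longrightarrow> dual_norm N (\<omega> i) \<le> 1"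
    and Inf_le: "\<And>\<xi> :: nat \<Rightarrow> real. (\<forall>i\<in>{1..T}. \<xi> i \<in> {-1, 1}) \<Longrightarrow>
      (INF x\<in>X. MAX i\<in>{1..T}. \<xi> i * (\<omega> i \<bullet> x)) \<le> - \<Delta>"
    using assms(7) by blast
  have \<omega>: "\<bar>\<omega> i \<bullet> x\<bar> \<le> N x" if "i \<in> {1..T}" for i x
    by (intro inner_le_of_dual_norm_le assms(1) dual that)
  obtain D \<phi> grad hess G where \<phi>: "convex_on D \<phi>" "twice_cont_diff_on D \<phi> grad hess"
    "compact G" "convex G" "G \<subseteq> D" "0 \<in> D" "\<phi> 0 = 0" "grad 0 = 0" "0 \<in> interior G"
    and frontier: "\<forall>x\<in>frontier G. \<phi> x > N x"
    and hess: "\<forall>e. \<forall>h\<in>G. e \<bullet> (hess h *v e) \<le> M * (N e)\<^sup>2"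
    and radius_G: "(SUP h\<in>G. N h) \<le> \<rho>"
    using assms(10) by (elim exE conjE) (rule that)
  obtain r0 where kernel: "smoothing_kernel N G \<phi> grad \<rho> r0 M"
    by (rule smoothing_kernel_of_barrier
        [OF assms(1,8) \<phi> frontier[rule_format] hess[rule_format] radius_G])
  \<comment> \<open>A larger \<open>\<theta>\<close> flattens the kernel, but \<open>T - 1\<close>
    offsets exceeding \<open>2 * (\<theta> * \<rho>)\<close>, together with the radius
    \<open>\<theta> * \<rho>\<close>, must fit into \<open>\<Delta> / 2\<close>.\<close>
  define \<theta> where "\<theta> = \<Delta> / (4 * real T * \<rho>)"
  have "\<theta> > 0" using assms by (simp add: \<theta>_def)
  define H \<Psi> p r where "H = (*\<^sub>R) \<theta> ` G" and "\<Psi> = (\<lambda>h. \<theta> * \<phi> (h /\<^sub>R \<theta>))"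
    and "p = (\<lambda>h. grad (h /\<^sub>R \<theta>))" and "r = \<theta> * r0"
  have kernel: "smoothing_kernel N H \<Psi> p (\<theta> * \<rho>) r (M / \<theta>)"
    unfolding H_def \<Psi>_def p_def r_def
    by (rule smoothing_kernel.smoothing_kernel_scaleR[OF kernel \<open>\<theta> > 0\<close>])

  \<comment> \<open>This is twice the radius plus \<open>\<Delta> / (4 * T^2)\<close>, which makes
    the inequality strict; the resulting gap is
    \<open>\<Delta> / 2 + \<Delta> / (4 * T^2)\<close>.\<close>
  define \<delta> where "\<delta> = \<Delta> * (2 * real T + 1) / (4 * (real T)\<^sup>2)"
  have radius: "\<theta> * \<rho> = \<Delta> / (4 * real T)" using assms(9) by (simp add: \<theta>_def)
  have \<delta>: "2 * (\<theta> * \<rho>) < \<delta>" "\<delta> \<ge> 0" and gap: "\<Delta> / 2 \<le> \<Delta> - \<theta> * \<rho> - real (T - 1) * \<delta>"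
    using assms(5,6) unfolding radius \<delta>_def
    by (simp_all add: of_nat_diff field_simps power2_eq_square)
  define a where "a = L / (2 powr (2 - \<kappa>) * (M / \<theta>) powr (\<kappa> - 1))"
  have "M / \<theta> > 0" using assms(8) \<open>\<theta> > 0\<close> by simp
  then have "a > 0"
    unfolding a_def using assms(11) by (intro divide_pos_pos mult_pos_pos powr_gt_zero[THEN iffD2]) auto
  \<comment> \<open>Nonemptiness of \<open>X\<close> is what gives \<open>INF\<close> over
    \<open>X\<close> its meaning.\<close>
  have "N 0 = 0" using assms(1) by (simp add: is_norm_def)
  then have "0 \<in> {x. N x \<le> 1}" by simp
  then have "X \<noteq> {}" using assms(4) by blast
  obtain f where f: "f \<in> smooth_family N \<kappa> L"
    "f (search_point R Orc f T) - (INF x\<in>X. f x) \<ge> a * (\<Delta> - \<theta> * \<rho> - real (T - 1) * \<delta>)"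
    using lower_bound_of_kernel[OF kernel \<open>M / \<theta> > 0\<close> \<omega> Inf_le assms(2) \<open>X \<noteq> {}\<close> assms(5) \<delta>
        assms(11-14) a_def, of R] by blast
  have "\<Delta> powr \<kappa> / (2 powr (\<kappa> + 1) * (\<rho> * M) powr (\<kappa> - 1)) * (L / real T powr (\<kappa> - 1))
      = a * (\<Delta> / 2)"
    unfolding a_def \<theta>_def using assms by (intro bound_constant_eq) auto
  also have "\<dots> \<le> a * (\<Delta> - \<theta> * \<rho> - real (T - 1) * \<delta>)"
    using gap \<open>a > 0\<close> by (intro mult_left_mono) auto
  also note f(2)
  finally show ?thesis using f(1) by blast
qed

end
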